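(* Let $p$ be a prime number and let $A$ and $B$ be finite subsets of $\mathbb{Z}/p\mathbb{Z}$ with $0\notin B$ which are of the same size $k$. If $k\leq\sqrt{\log_2 p}-1$, then there exists an acyclic matching $f:A\to B$.
   Context: Let $G$ be an additive abelian group and let $A,B$ be finite subsets of $G$ of the same cardinality with $0\notin B$. A matching from $A$ to $B$ is a bijection $f:A\to B$ such that $a+f(a)\notin A$ for every $a\in A$. The multiplicity function of a matching $f$ is $m_f:G\to\mathbb{Z}_{\ge 0}$, $m_f(x)=\#\{a\in A : a+f(a)=x\}$. A matching $f:A\to B$ is called acyclic if for every matching $g:A\to B$, $m_f=m_g$ implies $f=g$. *)

theory Defs
  imports Complex_Main "HOL-Computational_Algebra.Primes" "HOL-Algebra.Elementary_Groups"
begin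

(* The ambient abelian group is a HOL-Algebra structure, hence its operation is written
   multiplicatively: x \<otimes> y stands for x + y. Functions are total on the type, so matchings
   from A to B are compared on A only. *)

definition matching :: "('a, 'm) monoid_scheme \<Rightarrow> 'a set \<Rightarrow> 'a set \<Rightarrow> ('a \<Rightarrow> 'a) \<Rightarrow> bool"
  where "matching G A B f \<longleftrightarrow>
    bij_betw f A B \<and> (\<forall>a\<in>A. a \<otimes>\<^bsub>G\<^esub> f a \<notin> A)"

definition multiplicity_fun ::
    "('a, 'm) monoid_scheme \<Rightarrow> 'a set \<Rightarrow> ('a \<Rightarrow> 'a) \<Rightarrow> 'a \<Rightarrow> nat"
  where "multiplicity_fun G A f x = card {a \<in> A. a \<otimes>\<^bsub>G\<^esub> f a = x}"

definition acyclic_matching ::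
    "('a, 'm) monoid_scheme \<Rightarrow> 'a set \<Rightarrow> 'a set \<Rightarrow> ('a \<Rightarrow> 'a) \<Rightarrow> bool"
  where "acyclic_matching G A B f \<longleftrightarrow>
    matching G A B f \<and>
    (\<forall>g. matching G A B g \<longrightarrow>
      (\<forall>x\<in>carrier G. multiplicity_fun G A f x = multiplicity_fun G A g x) \<longrightarrow>
      (\<forall>a\<in>A. f a = g a))"

end

theory Submission
  imports Defs "HOL-Library.Multiset" "HOL-Library.FuncSet" "HOL-Number_Theory.Cong"
begin

text \<open>
  The proof moves the problem from \<open>\<int>/p\<int>\<close> to the integers, where the order can be used.

  Pigeonhole on the dilates of \<open>A \<union> B\<close> gives a dilation, invertible modulo \<open>p\<close>, that brings
  all of \<open>A \<union> B\<close> within distance less than \<open>p/4\<close> of \<open>0\<close>, as soon as \<open>4\<close> to the power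
  \<open>card (A \<union> B)\<close> is less than \<open>p\<close>. Sending a residue to the representative of its dilate closest
  to \<open>0\<close> is then injective on all residues, and additive on \<open>A \<union> B\<close> since no sum wraps around
  (\<open>rectification\<close>). Such a map carries acyclic matchings in the target back to the source
  (\<open>acyclic_matching_pullback\<close>). The hypothesis on \<open>k\<close> says that \<open>p\<close> is at least \<open>2\<close> to the
  power \<open>(k + 1)\<^sup>2\<close>, and \<open>(k + 1)\<^sup>2 \<ge> 4 * k\<close>.

  In a linearly ordered abelian group, first let \<open>B\<close> be positive. Take the smallest \<open>x\<close> outside \<open>A\<close>
  that is a sum \<open>a + b\<close>, send every \<open>a\<close> with \<open>x - a \<in> B\<close> to \<open>x - a\<close>, remove these pairs and
  repeat (\<open>greedy_extension\<close>). The value \<open>x\<close> is then attained as often as any bijection can attain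
  it, so a bijection with the same multiset of sums makes the same choices at every stage. The
  procedure never gets stuck, by a counting argument (\<open>exists_sum_outside\<close>). Negative \<open>B\<close> is the
  mirror image. In general, match the largest elements of \<open>A\<close> with the positive part of \<open>B\<close> and
  the others with the negative part: the two halves do not interact, and any competitor with the
  same sums must split in the same way because this split maximises the total of the upper sums
  (\<open>acyclic_bijection_ordered_group\<close>).
\<close>

section \<open>Bijections determined by their multiset of sums\<close>

definition sums_mset :: "'a::ab_group_add set \<Rightarrow> ('a \<Rightarrow> 'a) \<Rightarrow> 'a multiset"
  where "sums_mset A f = image_mset (\<lambda>a. a + f a) (mset_set A)"

text \<open>
  Acyclicity without the condition that sums avoid a set: a competitor with the same multiset of
  sums avoids the same sets anyway.
\<close>

definition determined_by_sums :: "'a::ab_group_add set \<Rightarrow> 'a set \<Rightarrow> ('a \<Rightarrow> 'a) \<Rightarrow> bool"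
  where "determined_by_sums A B f \<longleftrightarrow>
    (\<forall>g. bij_betw g A B \<longrightarrow> sums_mset A g = sums_mset A f \<longrightarrow> (\<forall>a\<in>A. g a = f a))"

lemma sums_mset_cong: "(\<And>a. a \<in> A \<Longrightarrow> f a = g a) \<Longrightarrow> sums_mset A f = sums_mset A g"
  unfolding sums_mset_def
  by (rule image_mset_cong) (metis elem_mset_set mset_set.infinite count_empty not_in_iff)

lemma sums_mset_Un:
  assumes "finite A" "finite A'" "A \<inter> A' = {}"
  shows "sums_mset (A \<union> A') f = sums_mset A f + sums_mset A' f"
  using assms by (simp add: sums_mset_def mset_set_Union)

lemma filter_sums_mset:
  "finite A \<Longrightarrow> filter_mset P (sums_mset A f) = sums_mset {a \<in> A. P (a + f a)} f"
  by (simp add: sums_mset_def filter_mset_image_mset)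

lemma size_sums_mset: "size (sums_mset A f) = card A"
  by (simp add: sums_mset_def)

lemma count_sums_mset:
  assumes "finite A"
  shows "count (sums_mset A f) x = card {a \<in> A. a + f a = x}"
proof -
  have "count (sums_mset A f) x = size (filter_mset (\<lambda>y. y = x) (sums_mset A f))"
    by (metis count_conv_size_mset filter_mset_cong)
  then show ?thesis using assms by (simp add: filter_sums_mset size_sums_mset)
qed

lemma sum_mset_sums_mset: "sum_mset (sums_mset A f) = \<Sum>A + (\<Sum>a\<in>A. f a)"
  by (simp add: sums_mset_def sum_unfold_sum_mset[symmetric] sum.distrib)

lemma bij_betw_remove_subset:
  assumes "bij_betw g A B" "S \<subseteq> A" "g ` S = T"
  shows "bij_betw g (A - S) (B - T)"
proof -
  have "g ` (A - S) = g ` A - g ` S"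
    using assms by (intro inj_on_image_set_diff[of g A]) (auto simp: bij_betw_def)
  then show ?thesis using assms by (auto simp: bij_betw_def inj_on_diff)
qed

section \<open>Positive second summands\<close>

text \<open>
  The greedy procedure cannot get stuck. Here \<open>A\<close> and \<open>B\<close> are what is left of \<open>U\<close> and \<open>V\<close>, and
  \<open>h\<close> is the assignment made so far. If it is stuck, let \<open>m\<close> be the largest element left. For
  every \<open>b \<in> V\<close> with \<open>m + b \<in> U\<close>, the element \<open>m + b\<close> exceeds \<open>m\<close>, hence is already
  assigned, and by the last hypothesis \<open>h (m + b)\<close> is another such element, one outside \<open>B\<close>. So
  the set of these \<open>b\<close>, which contains \<open>B\<close>, injects into its part outside \<open>B\<close>, which is smaller.
\<close>

lemma exists_sum_outside:
  fixes U V :: "'a::linordered_ab_group_add set"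
  assumes "finite U" "finite V" "\<And>v. v \<in> V \<Longrightarrow> 0 < v"
    and "A \<subseteq> U" "B \<subseteq> V" "A \<noteq> {}" "B \<noteq> {}"
    and "bij_betw h (U - A) (V - B)"
    and inv: "\<And>c a. c \<in> U - A \<Longrightarrow> a \<in> A \<Longrightarrow> a < c \<Longrightarrow> a + h c \<in> U"
  shows "\<exists>a\<in>A. \<exists>b\<in>B. a + b \<notin> U"
proof (rule ccontr)
  assume stuck: "\<not> ?thesis"
  define m where "m = Max A"
  have finA: "finite A" using assms finite_subset by blast
  have m: "m \<in> A" using finA \<open>A \<noteq> {}\<close> by (simp add: m_def)
  define W where "W = {b \<in> V. m + b \<in> U}"
  have BW: "B \<subseteq> W" using stuck m \<open>B \<subseteq> V\<close> by (auto simp: W_def)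
  have finW: "finite W" using \<open>finite V\<close> by (simp add: W_def)
  have rem: "m + b \<in> U - A" "m < m + b" if "b \<in> W" for b
  proof -
    show "m < m + b" using that assms(3) by (simp add: W_def)
    then have "m + b \<notin> A" using finA by (auto simp: m_def dest: Max_ge)
    then show "m + b \<in> U - A" using that by (simp add: W_def)
  qed
  have "(\<lambda>b. h (m + b)) ` W \<subseteq> W - B"
  proof
    fix y assume "y \<in> (\<lambda>b. h (m + b)) ` W"
    then obtain b where b: "b \<in> W" "y = h (m + b)" by blast
    have "y \<in> V - B" using b rem(1) assms(8) by (auto simp: bij_betw_def)
    moreover have "m + y \<in> U" using b inv[OF rem(1) m rem(2)] by simp
    ultimately show "y \<in> W - B" by (simp add: W_def)
  qed
  moreover have "inj_on (\<lambda>b. h (m + b)) W"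
  proof (rule inj_onI)
    fix x y assume "x \<in> W" "y \<in> W" "h (m + x) = h (m + y)"
    then have "m + x = m + y"
      using rem(1) assms(8) by (meson bij_betw_def inj_onD)
    then show "x = y" by simp
  qed
  ultimately have "card W \<le> card (W - B)"
    using finW by (meson card_inj_on_le finite_Diff)
  moreover have "card (W - B) < card W"
    using BW \<open>B \<noteq> {}\<close> finW by (intro psubset_card_mono) auto
  ultimately show False by simp
qed

text \<open>
  The last hypothesis is the trace that the earlier stages leave behind: \<open>c\<close> was assigned while
  \<open>x = c + h c\<close> was the smallest sum outside \<open>U\<close>, so for a smaller remaining \<open>a\<close> the sum
  \<open>a + h c\<close>, which was available too and lies below \<open>x\<close>, must be in \<open>U\<close>. It is what keeps the
  procedure from getting stuck, and it is carried along in the induction.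
\<close>

lemma greedy_extension:
  fixes U V :: "'a::linordered_ab_group_add set"
  assumes "finite U" "finite V" "\<And>v. v \<in> V \<Longrightarrow> 0 < v"
    and "A \<subseteq> U" "B \<subseteq> V" "card A = card B"
    and "bij_betw h (U - A) (V - B)"
    and "\<And>c a. c \<in> U - A \<Longrightarrow> a \<in> A \<Longrightarrow> a < c \<Longrightarrow> a + h c \<in> U"
  shows "\<exists>f. bij_betw f A B \<and> (\<forall>a\<in>A. a + f a \<notin> U) \<and> determined_by_sums A B f"
  using assms(4-)
proof (induction "card A" arbitrary: A B h rule: less_induct)
  case less
  note inv = less.prems(5)
  have fin: "finite A" "finite B"
    using less.prems \<open>finite U\<close> \<open>finite V\<close> finite_subset by blast+
  show ?case
  proof (cases "A = {}")
    case True
    then have "B = {}" using less.prems(3) fin by simp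
    then show ?thesis using True by (simp add: determined_by_sums_def bij_betw_def)
  next
    case False
    then have "B \<noteq> {}" using less.prems(3) fin by auto
    define X where "X = {a + b |a b. a \<in> A \<and> b \<in> B} - U"
    have finX: "finite X" unfolding X_def using fin by (intro finite_Diff finite_image_set2) auto
    have "X \<noteq> {}"
      using exists_sum_outside[OF assms(1-3) less.prems(1,2) False \<open>B \<noteq> {}\<close> less.prems(4) inv]
      by (auto simp: X_def)
    define x where "x = Min X"
    have xX: "x \<in> X" using finX \<open>X \<noteq> {}\<close> by (simp add: x_def)
    then have xU: "x \<notin> U" by (simp add: X_def)
    have minx: "a + b \<in> U" if "a \<in> A" "b \<in> B" "a + b < x" for a b
    proof (rule ccontr)
      assume "a + b \<notin> U"
      then have "a + b \<in> X" using that by (auto simp: X_def)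
      then have "x \<le> a + b" using finX by (simp add: x_def)
      then show False using that(3) by simp
    qed
    define S where "S = {a \<in> A. x - a \<in> B}"
    define T where "T = (\<lambda>a. x - a) ` S"
    have SA: "S \<subseteq> A" and TB: "T \<subseteq> B" by (auto simp: S_def T_def)
    have "S \<noteq> {}" using xX by (auto simp: X_def S_def)
    have injS: "inj_on (\<lambda>a. x - a) S" by (auto simp: inj_on_def)
    then have bijS: "bij_betw (\<lambda>a. x - a) S T" by (simp add: T_def bij_betw_def)
    then have cST: "card S = card T" by (rule bij_betw_same_card)
    have finS: "finite S" "finite T" using SA TB fin finite_subset by blast+
    define h' where "h' = (\<lambda>c. if c \<in> S then x - c else h c)"
    have c1: "card (A - S) < card A"
      using SA \<open>S \<noteq> {}\<close> fin by (intro psubset_card_mono) auto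
    have c2: "card (A - S) = card (B - T)"
      using SA TB finS cST less.prems(3) by (simp add: card_Diff_subset)
    have US: "U - (A - S) = (U - A) \<union> S" and VT: "V - (B - T) = (V - B) \<union> T"
      using SA TB less.prems(1,2) by auto
    have "bij_betw h' (U - A) (V - B)"
      using less.prems(4) SA by (subst bij_betw_cong[of _ _ h]) (auto simp: h'_def)
    moreover have "bij_betw h' S T"
      using bijS by (subst bij_betw_cong[of _ _ "\<lambda>a. x - a"]) (auto simp: h'_def)
    ultimately have b': "bij_betw h' (U - (A - S)) (V - (B - T))"
      unfolding US VT using TB by (intro bij_betw_combine) auto
    have inv': "a + h' c \<in> U" if "c \<in> U - (A - S)" "a \<in> A - S" "a < c" for c a
    proof (cases "c \<in> S")
      case True
      then have "x - c \<in> B" by (simp add: S_def)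
      moreover have "a + (x - c) < x" using \<open>a < c\<close> by (simp add: algebra_simps)
      ultimately show ?thesis using minx that True by (simp add: h'_def)
    next
      case False
      then show ?thesis using that inv by (auto simp: h'_def)
    qed
    have sub: "A - S \<subseteq> U" "B - T \<subseteq> V" using less.prems(1,2) by auto
    obtain f' where f': "bij_betw f' (A - S) (B - T)" "\<forall>a\<in>A - S. a + f' a \<notin> U"
      "determined_by_sums (A - S) (B - T) f'"
      using less.hyps[OF c1 sub c2 b' inv'] by blast
    define f where "f = (\<lambda>a. if a \<in> S then x - a else f' a)"
    have AS: "A = S \<union> (A - S)" and BT: "B = T \<union> (B - T)" using SA TB by auto
    have fS: "bij_betw f S T"
      using bijS by (subst bij_betw_cong[of _ _ "\<lambda>a. x - a"]) (auto simp: f_def)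
    moreover have "bij_betw f (A - S) (B - T)"
      using f'(1) by (subst bij_betw_cong[of _ _ f']) (auto simp: f_def)
    ultimately have fbij: "bij_betw f A B"
      by (subst AS, subst BT) (intro bij_betw_combine, auto)
    have "\<forall>a\<in>A. a + f a \<notin> U" using f'(2) xU by (auto simp: f_def)
    moreover have "determined_by_sums A B f"
      unfolding determined_by_sums_def
    proof (intro allI impI)
      fix g assume g: "bij_betw g A B" and eq: "sums_mset A g = sums_mset A f"
      \<comment> \<open>No bijection from \<open>A\<close> to \<open>B\<close> can attain \<open>x\<close> outside \<open>S\<close>, and \<open>f\<close> attains it on all of \<open>S\<close>.\<close>
      have into: "{a \<in> A. a + q a = x} \<subseteq> S" if "bij_betw q A B" for q
        using that by (auto simp: S_def bij_betw_def)
      have "{a \<in> A. a + f a = x} = S" using into[OF fbij] SA by (auto simp: f_def)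
      then have "card {a \<in> A. a + g a = x} = card S"
        using eq fin by (metis count_sums_mset)
      then have "{a \<in> A. a + g a = x} = S"
        using into[OF g] finS by (intro card_subset_eq) auto
      then have gS: "g a = f a" if "a \<in> S" for a
        using that by (auto simp: f_def algebra_simps)
      have "g ` S = T" using gS fS by (simp add: bij_betw_def)
      then have gr: "bij_betw g (A - S) (B - T)"
        using g SA by (intro bij_betw_remove_subset)
      have "sums_mset S g + sums_mset (A - S) g = sums_mset S f + sums_mset (A - S) f"
        using eq sums_mset_Un[of S "A - S"] finS fin AS by auto
      moreover have "sums_mset S g = sums_mset S f" using gS by (rule sums_mset_cong)
      moreover have "sums_mset (A - S) f = sums_mset (A - S) f'"
        by (rule sums_mset_cong) (simp add: f_def)
      ultimately have "sums_mset (A - S) g = sums_mset (A - S) f'" by simp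
      then have "\<forall>a\<in>A - S. g a = f' a"
        using f'(3) gr by (simp add: determined_by_sums_def)
      then show "\<forall>a\<in>A. g a = f a" using gS by (auto simp: f_def)
    qed
    ultimately show ?thesis using fbij by blast
  qed
qed

lemma acyclic_bijection_positive:
  fixes A B :: "'a::linordered_ab_group_add set"
  assumes "finite A" "finite B" "card A = card B" "\<And>b. b \<in> B \<Longrightarrow> 0 < b"
  shows "\<exists>f. bij_betw f A B \<and> (\<forall>a\<in>A. a + f a \<notin> A) \<and> determined_by_sums A B f"
  using greedy_extension[of A B A B id] assms by simp

lemma acyclic_bijection_negative:
  fixes A B :: "'a::linordered_ab_group_add set"
  assumes "finite A" "finite B" "card A = card B" "\<And>b. b \<in> B \<Longrightarrow> b < 0"
  shows "\<exists>f. bij_betw f A B \<and> (\<forall>a\<in>A. a + f a \<notin> A) \<and> determined_by_sums A B f"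
proof -
  have bu: "bij_betw uminus S (uminus ` S)" "bij_betw uminus (uminus ` S) S" for S :: "'a set"
    by (auto simp: bij_betw_def inj_on_def image_image)
  have "\<exists>f. bij_betw f (uminus ` A) (uminus ` B) \<and> (\<forall>a\<in>uminus ` A. a + f a \<notin> uminus ` A) \<and>
      determined_by_sums (uminus ` A) (uminus ` B) f"
    using assms by (intro acyclic_bijection_positive) (auto simp: card_image)
  then obtain f where f: "bij_betw f (uminus ` A) (uminus ` B)"
    "\<And>a. a \<in> A \<Longrightarrow> - a + f (- a) \<notin> uminus ` A" "determined_by_sums (uminus ` A) (uminus ` B) f"
    by auto
  define f' where "f' = (\<lambda>a. - f (- a))"
  have sm: "sums_mset (uminus ` A) (\<lambda>a. - q (- a)) = image_mset uminus (sums_mset A q)" for q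
    by (simp add: sums_mset_def image_mset_mset_set[symmetric] multiset.map_comp comp_def)
  have "bij_betw (uminus \<circ> f \<circ> uminus) A B"
    using bu f(1) by (meson bij_betw_trans)
  then have "bij_betw f' A B" by (simp add: f'_def comp_def)
  moreover have "\<forall>a\<in>A. a + f' a \<notin> A"
  proof (intro ballI notI)
    fix a assume "a \<in> A" "a + f' a \<in> A"
    then have "- (a + f' a) \<in> uminus ` A" by blast
    then show False using f(2)[OF \<open>a \<in> A\<close>] by (simp add: f'_def)
  qed
  moreover have "determined_by_sums A B f'"
    unfolding determined_by_sums_def
  proof (intro allI impI)
    fix g assume g: "bij_betw g A B" "sums_mset A g = sums_mset A f'"
    have "bij_betw (uminus \<circ> g \<circ> uminus) (uminus ` A) (uminus ` B)"
      using bu g(1) by (meson bij_betw_trans)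
    moreover have "sums_mset (uminus ` A) (\<lambda>a. - g (- a)) = sums_mset (uminus ` A) f"
      using sm[of g] sm[of f'] g(2) by (simp add: f'_def)
    ultimately have "\<forall>a\<in>uminus ` A. - g (- a) = f a"
      using f(3) by (simp add: determined_by_sums_def comp_def)
    then have "- g a = f (- a)" if "a \<in> A" for a using that by simp
    then show "\<forall>a\<in>A. g a = f' a" unfolding f'_def by (metis minus_minus)
  qed
  ultimately show ?thesis by blast
qed

section \<open>Arbitrary nonzero second summands\<close>

lemma exists_top_subset:
  fixes A :: "'a::linorder set"
  assumes "finite A" "n \<le> card A"
  shows "\<exists>T\<subseteq>A. card T = n \<and> (\<forall>x\<in>T. \<forall>y\<in>A - T. y < x)"
  using assms
proof (induction n)
  case 0
  then show ?case by (intro exI[of _ "{}"]) simp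
next
  case (Suc n)
  then obtain T where T: "T \<subseteq> A" "card T = n" "\<forall>x\<in>T. \<forall>y\<in>A - T. y < x" by auto
  have finT: "finite T" using T Suc finite_subset by blast
  define m where "m = Max (A - T)"
  have "A - T \<noteq> {}" using T Suc by auto
  then have m: "m \<in> A - T" unfolding m_def using Suc by (intro Max_in) auto
  have "y < m" if "y \<in> A - T" "y \<noteq> m" for y
    using that Suc.prems Max_ge[of "A - T" y] by (simp add: m_def order_less_le)
  then show ?case using T m finT by (intro exI[of _ "insert m T"]) auto
qed

lemma sum_top_subset:
  fixes A :: "'a::linordered_ab_group_add set"
  assumes "finite A" "T \<subseteq> A" "P \<subseteq> A" "card P = card T"
    and top: "\<forall>x\<in>T. \<forall>y\<in>A - T. y < x"
  shows "\<Sum>P \<le> \<Sum>T" and "\<Sum>P = \<Sum>T \<Longrightarrow> P = T"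
proof -
  have fin: "finite T" "finite P" using assms finite_subset by blast+
  have lt: "\<Sum>P < \<Sum>T" if "P \<noteq> T"
  proof -
    have "card (P - T) = card (T - P)"
      using card_le_sym_Diff[of P T] card_le_sym_Diff[of T P] fin assms(4) by simp
    then obtain q where q: "bij_betw q (P - T) (T - P)"
      using fin finite_same_card_bij by blast
    have "P - T \<noteq> {}"
      using that fin assms(4) by (metis Diff_eq_empty_iff card_subset_eq)
    have "\<Sum>(P - T) < sum q (P - T)"
    proof (rule sum_strict_mono)
      fix a assume a: "a \<in> P - T"
      then have "q a \<in> T" using q by (auto simp: bij_betw_def)
      then show "a < q a" using top a assms(3) by blast
    qed (use fin \<open>P - T \<noteq> {}\<close> in auto)
    also have "\<dots> = \<Sum>(T - P)" using sum.reindex_bij_betw[OF q, of "\<lambda>x. x"] by simp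
    finally show ?thesis
      using sum.Int_Diff[OF fin(2), of "\<lambda>x. x" T] sum.Int_Diff[OF fin(1), of "\<lambda>x. x" P]
      by (simp add: Int_commute)
  qed
  show "\<Sum>P \<le> \<Sum>T" using lt by (cases "P = T") auto
  show "P = T" if "\<Sum>P = \<Sum>T" using lt that by auto
qed

text \<open>
  A sum from the upper half exceeds its first summand, hence all of the lower half; a sum from the
  lower half is below its first summand, hence below all of the upper half and its sums. So the
  avoidance conditions and the sets of sums of the two halves are separate. If
  \<open>g\<close> has the same sums, let \<open>P\<close> be the set where \<open>g\<close> attains the sums of the upper half. The
  totals agree, so \<open>P\<close> and \<open>g ` P\<close> together weigh as much as the top part of \<open>A\<close> and the positive
  part of \<open>B\<close>. Those are the unique heaviest subsets of their sizes, so \<open>g\<close> respects the split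
  and the two halves can be compared separately.
\<close>

theorem acyclic_bijection_ordered_group:
  fixes A B :: "'a::linordered_ab_group_add set"
  assumes "finite A" "finite B" "card A = card B" "0 \<notin> B"
  shows "\<exists>f. bij_betw f A B \<and> (\<forall>a\<in>A. a + f a \<notin> A) \<and> determined_by_sums A B f"
proof -
  define B1 where "B1 = {b \<in> B. 0 < b}"
  define B2 where "B2 = B - B1"
  have B1B: "B1 \<subseteq> B" and finB1: "finite B1" and finB2: "finite B2"
    using assms(2) by (auto simp: B1_def B2_def)
  have neg: "b < 0" if "b \<in> B2" for b
    using that assms(4) by (auto simp: B1_def B2_def not_less order_le_less)
  have topB: "\<forall>x\<in>B1. \<forall>y\<in>B - B1. y < x"
    using neg by (fastforce simp: B1_def B2_def)
  have "card B1 \<le> card A" using assms B1B by (simp add: card_mono)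
  then obtain A1 where A1: "A1 \<subseteq> A" "card A1 = card B1" and topA: "\<forall>x\<in>A1. \<forall>y\<in>A - A1. y < x"
    using exists_top_subset[OF assms(1)] by meson
  define A2 where "A2 = A - A1"
  have fin: "finite A1" "finite A2" using A1 assms finite_subset by (auto simp: A2_def)
  have "card A2 = card B2"
    using A1 B1B fin finB1 assms by (simp add: A2_def B2_def card_Diff_subset)
  then obtain f2 where f2: "bij_betw f2 A2 B2" "\<forall>a\<in>A2. a + f2 a \<notin> A2" "determined_by_sums A2 B2 f2"
    using acyclic_bijection_negative[OF fin(2) finB2 _ neg] by blast
  obtain f1 where f1: "bij_betw f1 A1 B1" "\<forall>a\<in>A1. a + f1 a \<notin> A1" "determined_by_sums A1 B1 f1"
    using acyclic_bijection_positive[OF fin(1) finB1 A1(2)] by (auto simp: B1_def)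
  define f where "f = (\<lambda>a. if a \<in> A1 then f1 a else f2 a)"
  have AU: "A = A1 \<union> A2" and disj: "A1 \<inter> A2 = {}" and BU: "B = B1 \<union> B2"
    using A1 B1B by (auto simp: A2_def B2_def)
  have b1: "bij_betw f A1 B1"
    using f1(1) by (subst bij_betw_cong[of _ _ f1]) (auto simp: f_def)
  have b2: "bij_betw f A2 B2"
    using f2(1) disj by (subst bij_betw_cong[of _ _ f2]) (auto simp: f_def)
  have fbij: "bij_betw f A B"
    unfolding AU BU using b1 b2 by (rule bij_betw_combine) (auto simp: B2_def)
  have up: "a < a + f a" if "a \<in> A1" for a
    using that b1 by (auto simp: bij_betw_def B1_def)
  have down: "a + f a < a" if "a \<in> A2" for a
    using that b2 neg by (auto simp: bij_betw_def)
  have sep: "y < x" if "x \<in> A1" "y \<in> A2" for x y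
    using that topA by (auto simp: A2_def)
  have avoid: "a + f a \<notin> A" if "a \<in> A" for a
  proof (cases "a \<in> A1")
    case True
    then have "a + f a \<notin> A1" using f1(2) by (simp add: f_def)
    moreover have "a + f a \<notin> A2" using up[OF True] sep[OF True] by force
    ultimately show ?thesis by (simp add: AU)
  next
    case False
    then have "a \<in> A2" using that by (simp add: A2_def)
    then have "a + f a \<notin> A2" using f2(2) False by (simp add: f_def)
    moreover have "a + f a \<notin> A1" using down[OF \<open>a \<in> A2\<close>] sep[OF _ \<open>a \<in> A2\<close>] by force
    ultimately show ?thesis by (simp add: AU)
  qed
  have "determined_by_sums A B f"
    unfolding determined_by_sums_def
  proof (intro allI impI)
    fix g assume g: "bij_betw g A B" and eq: "sums_mset A g = sums_mset A f"
    define X where "X = (\<lambda>a. a + f a) ` A1"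
    define P where "P = {a \<in> A. a + g a \<in> X}"
    have notX: "a + f a \<notin> X" if a: "a \<in> A2" for a
    proof
      assume "a + f a \<in> X"
      then obtain c where c: "c \<in> A1" "a + f a = c + f c" by (auto simp: X_def)
      then have "c + f c < c" using down[OF a] sep[OF c(1) a] c(2) by (metis order_less_trans)
      then show False using up[OF c(1)] by simp
    qed
    have fA1: "{a \<in> A. a + f a \<in> X} = A1"
      using notX by (auto simp: AU X_def)
    have fA2: "{a \<in> A. a + f a \<notin> X} = A2"
      using notX disj by (auto simp: AU X_def)
    have eqP: "sums_mset P g = sums_mset A1 f"
      using filter_sums_mset[OF assms(1), of "\<lambda>y. y \<in> X"] eq fA1 unfolding P_def by metis
    have eqQ: "sums_mset (A - P) g = sums_mset A2 f"
    proof -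
      have "A - P = {a \<in> A. a + g a \<notin> X}" by (auto simp: P_def)
      then show ?thesis
        using filter_sums_mset[OF assms(1), of "\<lambda>y. y \<notin> X"] eq fA2 by metis
    qed
    have PA: "P \<subseteq> A" by (auto simp: P_def)
    have cP: "card P = card A1" using eqP by (metis size_sums_mset)
    have gP: "inj_on g P" using g PA by (meson bij_betw_def inj_on_subset)
    have gPB: "g ` P \<subseteq> B" using g PA by (auto simp: bij_betw_def)
    have cgP: "card (g ` P) = card B1" using gP cP A1 by (simp add: card_image)
    have "\<Sum>P + \<Sum>(g ` P) = \<Sum>A1 + \<Sum>B1"
    proof -
      have "\<Sum>P + (\<Sum>a\<in>P. g a) = \<Sum>A1 + (\<Sum>a\<in>A1. f a)"
        using eqP by (metis sum_mset_sums_mset)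
      moreover have "(\<Sum>a\<in>A1. f a) = \<Sum>B1"
        using sum.reindex_bij_betw[OF b1, of "\<lambda>x. x"] by simp
      moreover have "\<Sum>(g ` P) = (\<Sum>a\<in>P. g a)" using gP by (simp add: sum.reindex)
      ultimately show ?thesis by simp
    qed
    moreover have "\<Sum>P \<le> \<Sum>A1" by (rule sum_top_subset(1)[OF assms(1) A1(1) PA cP topA])
    moreover have "\<Sum>(g ` P) \<le> \<Sum>B1" by (rule sum_top_subset(1)[OF assms(2) B1B gPB cgP topB])
    ultimately have "\<Sum>P = \<Sum>A1" "\<Sum>(g ` P) = \<Sum>B1"
      by (metis add_le_cancel_left add_le_cancel_right order_antisym add_mono)+
    then have PA1: "P = A1" and gPB1: "g ` P = B1"
      using sum_top_subset(2)[OF assms(1) A1(1) PA cP topA]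
        sum_top_subset(2)[OF assms(2) B1B gPB cgP topB] by auto
    have g1: "bij_betw g A1 B1" using gP gPB1 PA1 by (simp add: bij_betw_def)
    have g2: "bij_betw g A2 B2"
      unfolding A2_def B2_def using g A1(1) gPB1 PA1 by (intro bij_betw_remove_subset) auto
    have "sums_mset A1 g = sums_mset A1 f1" "sums_mset A2 g = sums_mset A2 f2"
      using eqP eqQ PA1 sums_mset_cong[of A1 f f1] sums_mset_cong[of A2 f f2] disj
      by (auto simp: f_def A2_def)
    then have "\<forall>a\<in>A1. g a = f1 a" "\<forall>a\<in>A2. g a = f2 a"
      using f1(3) f2(3) g1 g2 by (auto simp: determined_by_sums_def)
    then show "\<forall>a\<in>A. g a = f a" using disj by (auto simp: AU f_def)
  qed
  then show ?thesis using fbij avoid by blast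
qed

section \<open>Pulling back along partially additive maps\<close>

text \<open>
  By additivity, the multiset of sums in the ordered group is the image under \<open>\<phi>\<close> of the multiset
  of sums in \<open>G\<close>, so equal multiplicities in \<open>G\<close> give equal multisets there. Injectivity on a set
  that also contains the sums \<open>a \<otimes> b\<close> ensures that no \<open>b \<in> B\<close> is sent to \<open>0\<close>: otherwise
  \<open>a \<otimes> b\<close> and \<open>a\<close> would have the same image.
\<close>

lemma acyclic_matching_pullback:
  fixes G (structure) and \<phi> :: "'a \<Rightarrow> 'b::linordered_ab_group_add"
  assumes "group G" and AB: "A \<subseteq> carrier G" "B \<subseteq> carrier G"
    and fin: "finite A" "finite B" "card A = card B" and "\<one> \<notin> B"
    and inj: "inj_on \<phi> (carrier G)"
    and add: "\<And>a b. a \<in> A \<Longrightarrow> b \<in> B \<Longrightarrow> \<phi> (a \<otimes> b) = \<phi> a + \<phi> b"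
  shows "\<exists>f. acyclic_matching G A B f"
proof -
  interpret group G by fact
  have injA: "inj_on \<phi> A" and injB: "inj_on \<phi> B" using inj AB by (auto intro: inj_on_subset)
  have "0 \<notin> \<phi> ` B"
  proof
    assume "0 \<in> \<phi> ` B"
    then obtain b where b: "b \<in> B" "\<phi> b = 0" by auto
    then obtain a where a: "a \<in> A" using fin by (metis card_0_eq empty_iff equals0I)
    then have "\<phi> (a \<otimes> b) = \<phi> a" using b add by simp
    then have "a \<otimes> b = a" using inj a b AB by (meson inj_onD m_closed subsetD)
    then show False using a b AB \<open>\<one> \<notin> B\<close> by (metis l_cancel_one subsetD)
  qed
  then obtain F where F: "bij_betw F (\<phi> ` A) (\<phi> ` B)" "\<And>a. a \<in> A \<Longrightarrow> \<phi> a + F (\<phi> a) \<notin> \<phi> ` A"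
    "determined_by_sums (\<phi> ` A) (\<phi> ` B) F"
    using acyclic_bijection_ordered_group[of "\<phi> ` A" "\<phi> ` B"] fin injA injB
    by (auto simp: card_image)
  define f where "f = inv_into B \<phi> \<circ> (F \<circ> \<phi>)"
  have bA: "bij_betw \<phi> A (\<phi> ` A)" and bB: "bij_betw \<phi> B (\<phi> ` B)"
    using injA injB by (auto simp: bij_betw_def)
  have fbij: "bij_betw f A B"
    unfolding f_def
    using bij_betw_trans[OF bij_betw_trans[OF bA F(1)] bij_betw_inv_into[OF bB]] by simp
  have Ff: "\<phi> (f a) = F (\<phi> a)" if "a \<in> A" for a
    using that F(1) by (auto simp: f_def bij_betw_def intro!: f_inv_into_f)
  have fm: "matching G A B f"
    unfolding matching_def
  proof (intro conjI ballI notI)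
    fix a assume a: "a \<in> A" "a \<otimes> f a \<in> A"
    then have "\<phi> (a \<otimes> f a) = \<phi> a + F (\<phi> a)"
      using add[of a "f a"] fbij Ff by (auto simp: bij_betw_def)
    then show False using F(2)[OF a(1)] a(2) by (metis image_eqI)
  qed (rule fbij)
  have "\<forall>a\<in>A. f a = g a"
    if g: "matching G A B g"
      and m: "\<forall>x\<in>carrier G. multiplicity_fun G A f x = multiplicity_fun G A g x" for g
  proof -
    have gbij: "bij_betw g A B" using g by (simp add: matching_def)
    have mem: "a \<otimes> q a \<in> carrier G" if "bij_betw q A B" "a \<in> A" for q a
      using that AB by (auto simp: bij_betw_def)
    have cnt: "count (image_mset (\<lambda>a. a \<otimes> q a) (mset_set A)) x = multiplicity_fun G A q x" for q x
    proof -
      have "count (image_mset (\<lambda>a. a \<otimes> q a) (mset_set A)) x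
          = size (filter_mset (\<lambda>y. y = x) (image_mset (\<lambda>a. a \<otimes> q a) (mset_set A)))"
        by (metis count_conv_size_mset filter_mset_cong)
      then show ?thesis using fin by (simp add: filter_mset_image_mset multiplicity_fun_def)
    qed
    have "image_mset (\<lambda>a. a \<otimes> f a) (mset_set A) = image_mset (\<lambda>a. a \<otimes> g a) (mset_set A)"
    proof (rule multiset_eqI, unfold cnt)
      fix x show "multiplicity_fun G A f x = multiplicity_fun G A g x"
      proof (cases "x \<in> carrier G")
        case False
        then have "{a \<in> A. a \<otimes> f a = x} = {}" "{a \<in> A. a \<otimes> g a = x} = {}"
          using mem fbij gbij by blast+
        then show ?thesis by (simp only: multiplicity_fun_def)
      qed (use m in simp)
    qed
    then have eq: "image_mset \<phi> (image_mset (\<lambda>a. a \<otimes> f a) (mset_set A))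
        = image_mset \<phi> (image_mset (\<lambda>a. a \<otimes> g a) (mset_set A))" by simp
    define H where "H = \<phi> \<circ> (g \<circ> inv_into A \<phi>)"
    have Hg: "H (\<phi> a) = \<phi> (g a)" if "a \<in> A" for a
      using that injA by (simp add: H_def)
    have Hbij: "bij_betw H (\<phi> ` A) (\<phi> ` B)"
      unfolding H_def using bij_betw_trans[OF bij_betw_trans[OF bij_betw_inv_into[OF bA] gbij] bB]
      by simp
    have push: "sums_mset (\<phi> ` A) Q = image_mset \<phi> (image_mset (\<lambda>a. a \<otimes> q a) (mset_set A))"
      if "bij_betw q A B" "\<And>a. a \<in> A \<Longrightarrow> Q (\<phi> a) = \<phi> (q a)" for q Q
    proof -
      have "\<phi> a + Q (\<phi> a) = \<phi> (a \<otimes> q a)" if "a \<in> A" for a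
        using that \<open>bij_betw q A B\<close> \<open>\<And>a. a \<in> A \<Longrightarrow> Q (\<phi> a) = \<phi> (q a)\<close> add
        by (auto simp: bij_betw_def)
      then have "image_mset (\<lambda>a. \<phi> a + Q (\<phi> a)) (mset_set A)
          = image_mset (\<lambda>a. \<phi> (a \<otimes> q a)) (mset_set A)"
        using fin by (intro image_mset_cong) simp
      then show ?thesis
        by (simp add: sums_mset_def image_mset_mset_set[OF injA, symmetric]
            multiset.map_comp comp_def)
    qed
    have "sums_mset (\<phi> ` A) H = sums_mset (\<phi> ` A) F"
      using push[OF gbij Hg] push[OF fbij] Ff eq by simp
    then have "\<forall>a\<in>A. \<phi> (g a) = \<phi> (f a)"
      using F(3) Hbij Hg Ff by (auto simp: determined_by_sums_def)
    moreover have "f a \<in> B" "g a \<in> B" if "a \<in> A" for a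
      using that fbij gbij by (auto simp: bij_betw_def)
    ultimately show ?thesis using injB by (metis inj_onD)
  qed
  then show ?thesis using fm by (auto simp: acyclic_matching_def)
qed

section \<open>Rectification of small sets of residues\<close>

lemma eq_of_cong_of_small:
  fixes x y n :: int
  assumes "[x = y] (mod n)" "\<bar>x - y\<bar> < n"
  shows "x = y"
  using assms zdvd_imp_le[of n "\<bar>x - y\<bar>"] by (force simp: cong_iff_dvd_diff)

text \<open>
  Simultaneous Dirichlet approximation: cut the residues into four intervals of length \<open>p/4\<close>. There
  are more multipliers \<open>t\<close> than patterns of intervals for the points \<open>t * x\<close>, so two multipliers
  share a pattern, and their difference moves every \<open>x \<in> S\<close> to within \<open>p/4\<close> of \<open>0\<close>.
\<close>

lemma common_short_dilation:
  fixes S :: "int set" and p :: nat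
  assumes "0 < p" "finite S" "4 ^ card S < p"
  shows "\<exists>d. \<not> int p dvd d \<and> (\<forall>x\<in>S. \<exists>r. [r = d * x] (mod int p) \<and> 4 * \<bar>r\<bar> < int p)"
proof -
  define box where "box = (\<lambda>t::int. \<lambda>x\<in>S. 4 * (t * x mod int p) div int p)"
  have "box \<in> {0..<int p} \<rightarrow> (S \<rightarrow>\<^sub>E {0..<4})"
  proof
    fix t
    have "4 * (t * x mod int p) div int p < 4" for x
    proof -
      let ?r = "t * x mod int p"
      have "(4 * ?r div int p) * int p + 4 * ?r mod int p = 4 * ?r" by (rule div_mult_mod_eq)
      moreover have "0 \<le> 4 * ?r mod int p" "?r < int p" using \<open>0 < p\<close> by auto
      ultimately have "(4 * ?r div int p) * int p < 4 * int p" by linarith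
      then show ?thesis using \<open>0 < p\<close> by (simp add: mult_less_cancel_right)
    qed
    then show "box t \<in> S \<rightarrow>\<^sub>E {0..<4}"
      using \<open>0 < p\<close> by (auto simp: box_def pos_imp_zdiv_nonneg_iff)
  qed
  moreover have "card (S \<rightarrow>\<^sub>E {0..<4::int}) < card {0..<int p}"
    using assms by (simp add: card_PiE)
  moreover have "finite (S \<rightarrow>\<^sub>E {0..<4::int})" using assms by (intro finite_PiE) auto
  ultimately have "\<not> inj_on box {0..<int p}"
    using card_inj_on_le[of box "{0..<int p}" "S \<rightarrow>\<^sub>E {0..<4}"] by fastforce
  then obtain t u where tu: "t \<in> {0..<int p}" "u \<in> {0..<int p}" "t \<noteq> u" "box t = box u"
    by (auto simp: inj_on_def)
  have "\<bar>t - u\<bar> < int p" using tu(1,2) by (simp add: abs_less_iff)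
  then have "\<not> int p dvd t - u"
    using tu(3) eq_of_cong_of_small[of t u "int p"] by (auto simp: cong_iff_dvd_diff)
  moreover have "\<exists>r. [r = (t - u) * x] (mod int p) \<and> 4 * \<bar>r\<bar> < int p" if "x \<in> S" for x
  proof (intro exI conjI)
    let ?a = "t * x mod int p" and ?b = "u * x mod int p"
    show "[?a - ?b = (t - u) * x] (mod int p)"
      by (simp add: cong_def mod_diff_eq left_diff_distrib)
    have "4 * ?a div int p = 4 * ?b div int p"
      using tu(4) that by (auto simp: box_def dest: fun_cong[of _ _ x])
    then have "4 * ?a - 4 * ?b = 4 * ?a mod int p - 4 * ?b mod int p"
      by (metis add_diff_cancel_left div_mult_mod_eq)
    moreover have "0 \<le> 4 * ?a mod int p" "4 * ?a mod int p < int p"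
      "0 \<le> 4 * ?b mod int p" "4 * ?b mod int p < int p"
      using \<open>0 < p\<close> by auto
    ultimately show "4 * \<bar>?a - ?b\<bar> < int p" by (smt (verit))
  qed
  ultimately show ?thesis by blast
qed

text \<open>
  The map sends \<open>x\<close> to the representative of \<open>d * x\<close> closest to \<open>0\<close>, for a multiplier \<open>d\<close> that
  makes all of \<open>S\<close> short. Sums of two short representatives stay below \<open>p/2\<close> in absolute value,
  so they are themselves closest representatives.
\<close>

lemma rectification:
  fixes S :: "int set" and p :: nat
  assumes "prime p" "finite S" "4 ^ card S < p"
  shows "\<exists>\<phi> :: int \<Rightarrow> int. inj_on \<phi> {0..<int p} \<and>
    (\<forall>x\<in>S. \<forall>y\<in>S. \<phi> ((x + y) mod int p) = \<phi> x + \<phi> y)"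
proof -
  have p: "0 < p" using assms(1) by (rule prime_gt_0_nat)
  obtain d where d: "\<not> int p dvd d" and
    short: "\<And>x. x \<in> S \<Longrightarrow> \<exists>r. [r = d * x] (mod int p) \<and> 4 * \<bar>r\<bar> < int p"
    using common_short_dilation[OF p assms(2,3)] by blast
  define \<phi> where "\<phi> = (\<lambda>x. let r = d * x mod int p in if 2 * r < int p then r else r - int p)"
  have cong: "[\<phi> x = d * x] (mod int p)" for x
    by (auto simp: \<phi>_def Let_def cong_def)
  have range: "- int p \<le> 2 * \<phi> x" "2 * \<phi> x < int p" for x
  proof -
    have "0 \<le> d * x mod int p" "d * x mod int p < int p" using p by auto
    then show "- int p \<le> 2 * \<phi> x" "2 * \<phi> x < int p" by (auto simp: \<phi>_def Let_def)
  qed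
  have uniq: "\<phi> x = r" if "[r = d * x] (mod int p)" "2 * \<bar>r\<bar> < int p" for x r
  proof (rule eq_of_cong_of_small)
    show "[\<phi> x = r] (mod int p)" using cong that(1) by (metis cong_sym cong_trans)
    show "\<bar>\<phi> x - r\<bar> < int p" using range[of x] that(2) by linarith
  qed
  have small: "4 * \<bar>\<phi> x\<bar> < int p" if x: "x \<in> S" for x
  proof -
    obtain r where r: "[r = d * x] (mod int p)" "4 * \<bar>r\<bar> < int p" using short x by blast
    then have "\<phi> x = r" by (intro uniq) auto
    then show ?thesis using r by simp
  qed
  have "inj_on \<phi> {0..<int p}"
  proof (rule inj_onI)
    fix x y assume xy: "x \<in> {0..<int p}" "y \<in> {0..<int p}" "\<phi> x = \<phi> y"
    have "[d * x = d * y] (mod int p)" using cong xy(3) by (metis cong_sym cong_trans)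
    then have "int p dvd d * (x - y)" by (simp add: cong_iff_dvd_diff right_diff_distrib)
    then have "int p dvd x - y" using d assms(1) by (simp add: prime_dvd_mult_iff)
    then show "x = y"
      using xy by (intro eq_of_cong_of_small[of _ _ "int p"]) (auto simp: cong_iff_dvd_diff)
  qed
  moreover have "\<phi> ((x + y) mod int p) = \<phi> x + \<phi> y" if "x \<in> S" "y \<in> S" for x y
  proof (rule uniq)
    have "[\<phi> x + \<phi> y = d * x + d * y] (mod int p)" by (intro cong_add cong)
    moreover have "[d * ((x + y) mod int p) = d * x + d * y] (mod int p)"
      by (simp add: cong_def mod_mult_right_eq distrib_left)
    ultimately show "[\<phi> x + \<phi> y = d * ((x + y) mod int p)] (mod int p)"
      by (metis cong_sym cong_trans)
    show "2 * \<bar>\<phi> x + \<phi> y\<bar> < int p" 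
      using small[OF that(1)] small[OF that(2)] by (smt (verit))
  qed
  ultimately show ?thesis by blast
qed

text \<open>
  The inequality is strict because \<open>p\<close>, being prime, is not a power of \<open>2\<close> with exponent \<open>4 * k\<close>.
\<close>

lemma four_power_less_prime:
  fixes p k :: nat
  assumes "prime p" "real k \<le> sqrt (log 2 (real p)) - 1"
  shows "4 ^ (2 * k) < p"
proof -
  have p: "1 < p" using assms(1) by (rule prime_gt_1_nat)
  have "(real k + 1)\<^sup>2 \<le> (sqrt (log 2 (real p)))\<^sup>2"
    using assms(2) by (intro power_mono) auto
  also have "\<dots> = log 2 (real p)" using p by simp
  finally have "real ((k + 1)\<^sup>2) \<le> log 2 (real p)" by (simp add: add.commute)
  then have "2 powr real ((k + 1)\<^sup>2) \<le> real p" using p by (subst (asm) le_log_iff) auto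
  then have "real (2 ^ ((k + 1)\<^sup>2)) \<le> real p" by (subst (asm) powr_realpow) auto
  then have "2 ^ ((k + 1)\<^sup>2) \<le> p" by (simp only: of_nat_le_iff)
  moreover have "4 * k \<le> (k + 1)\<^sup>2"
  proof -
    have "0 \<le> (int k - 1)\<^sup>2" by simp
    then have "int (4 * k) \<le> int ((k + 1)\<^sup>2)" by (simp add: power2_eq_square algebra_simps)
    then show ?thesis by (simp only: of_nat_le_iff)
  qed
  ultimately have "(2::nat) ^ (4 * k) \<le> p"
    by (meson one_le_numeral order_trans power_increasing)
  moreover have "p \<noteq> 2 ^ (4 * k)"
    using assms(1) by (auto simp: prime_power_iff)
  moreover have "(4::nat) ^ (2 * k) = 2 ^ (4 * k)"
    by (simp add: power_mult)
  ultimately show ?thesis by simp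
qed

section \<open>Acyclic matchings between small sets of residues\<close>

theorem theorem1p3:
  fixes p k :: nat and A B :: "int set"
  assumes "prime p"
    and "A \<subseteq> carrier (integer_mod_group p)" and "finite A"
    and "B \<subseteq> carrier (integer_mod_group p)" and "finite B"
    and "\<one>\<^bsub>integer_mod_group p\<^esub> \<notin> B"
    and "card A = k" and "card B = k"
    and "real k \<le> sqrt (log 2 (real p)) - 1"
  shows "\<exists>f. acyclic_matching (integer_mod_group p) A B f"
proof -
  have "card (A \<union> B) \<le> 2 * k" using card_Un_le[of A B] assms(7,8) by simp
  then have "(4::nat) ^ card (A \<union> B) \<le> 4 ^ (2 * k)" by (intro power_increasing) auto
  then have "4 ^ card (A \<union> B) < p" using four_power_less_prime[OF assms(1,9)] by linarith
  then obtain \<phi> :: "int \<Rightarrow> int" where \<phi>: "inj_on \<phi> {0..<int p}"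
    "\<forall>x\<in>A \<union> B. \<forall>y\<in>A \<union> B. \<phi> ((x + y) mod int p) = \<phi> x + \<phi> y"
    using rectification[OF assms(1), of "A \<union> B"] assms(3,5) by blast
  have "carrier (integer_mod_group p) = {0..<int p}"
    using prime_gt_0_nat[OF assms(1)] by (simp add: carrier_integer_mod_group)
  then show ?thesis
    using assms \<phi> by (intro acyclic_matching_pullback[of _ A B \<phi>]) auto
qed

end
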